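(* Let $\Gamma$ be a conservative $L$-connection on $M$ with horizontal projector $h$ and curvature $\Omega$. Let $D$ be the Berwald $L$-lift of $\Gamma$, with curvature tensor $\mathbf R$, and put $R(X,Y)Z=\mathbf R(hX,hY)LZ$. Then for all $X,Y,Z\in\mathfrak X(M)$, with $\mathfrak S$ denoting the cyclic sum over $X,Y,Z$: (a) $\mathfrak S\,(D_{hX}\Omega)(Y,Z)=0$. (b) $\mathfrak S\,(D_{LX}\Omega)(Y,Z)=0$. (c) $\mathfrak S\,(D_{LX}R)(Y,Z)=0$ (as an endomorphism, $R(Y,Z)$ being the map $W\mapsto R(Y,Z)W$).
   Context: Everything is $C^\infty$. $M$ is a manifold of dimension $2n$ and $\mathfrak X(M)$ is its Lie algebra of vector fields. A vector $k$-form is a $TM$-valued (skew) $k$-form; a vector $1$-form is a field of endomorphisms of $TM$. Brackets of vector forms are Fr\"olicher--Nijenhuis brackets: for a vector field $X$ and vector $1$-forms $K,N$, $[X,K]Y=[X,KY]-K[X,Y]$, $[K,X]=-[X,K]$, and $$[K,N](X,Y)=[KX,NY]+[NX,KY]+KN[X,Y]+NK[X,Y]-K[NX,Y]-N[KX,Y]-K[X,NY]-N[X,KY].$$ $L$ is a fixed vector $1$-form on $M$ of constant rank $n$ with $[L,L]=0$ and $\mathrm{Im}(L_z)=\mathrm{Ker}(L_z)$ for all $z\in M$ (so $L^2=0$). The vertical bundle is $V(M)=\mathrm{Im}\,L=\mathrm{Ker}\,L$. $C$ denotes the canonical vector field: a fixed vertical vector field on $M$ with $[C,L]=-L$. An $L$-connection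 on $M$ is a vector $1$-form $\Gamma$ with $L\Gamma=L$ and $\Gamma L=-L$; its horizontal projector is $h=\frac12(I+\Gamma)$; its curvature is $\Omega=-\frac12[h,h]$. $\Gamma$ is homogeneous if $[C,\Gamma]=0$. An $L$-spray is a vector field $S$ with $LS=C$ and $[C,S]=S$. A homogeneous $\Gamma$ is conservative if $\Gamma=[L,S]$ for some $L$-spray $S$. A linear connection $D$ on $M$ is $L$-almost-tangent if $D_X(LY)=L(D_XY)$ for all $X,Y$. Put $K(X)=D_XC$. $D$ is $L$-regular if it is $L$-almost-tangent and $K$ restricts to an isomorphism $V(M)\to V(M)$, with inverse $\varphi$; the $L$-connection induced by $D$ is then $I-2\varphi\circ K$, and $D$ is reducible if $D\Gamma=0$ for its induced $L$-connection $\Gamma$. $D$ is $L$-normal if it is $L$-almost-tangent and $D_{LX}C=LX$ for all $X$ (then it is $L$-regular). An $L$-lift of $\Gamma$ is an $L$-normal linear connection whose induced $L$-connection is $\Gamma$; it is a reducible $L$-lift if it is moreover reducible. The torsion and curvature of $D$ are $\mathbf T(X,Y)=D_XY-D_YX-[X,Y]$ and $\mathbf R(X,Y)Z=D_XD_YZ-D_YD_XZ-D_{[X,Y]}Z$. The Berwald $L$-lift of a homogeneous $L$-connection $\Gamma$ is the unique reducible $L$-lift of $\Gamma$ with $\mathbf T(LX,Y)=0$ for all $X,Y$ (it exists). Covariant derivatives of tensors are the usual ones, e.g. $(D_W\Omega)(X,Y)=D_W(\Omega(X,Y))-\Omega(D_WX,Y)-\Omega(X,D_WY)$. *)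

theory Defs
  imports "HOL-Analysis.Analysis" "HOL-Library.Function_Algebras"
begin

text \<open>
  Sums, differences, products and zero of functions are taken pointwise
  (\<^theory>\<open>HOL-Library.Function_Algebras\<close>); this covers smooth functions, tangent vectors
  and vector fields alike.
\<close>

section \<open>Smooth manifolds\<close>

text \<open>
  Class \<open>C\<^sup>k\<close> on an open set of a finite-dimensional normed space: all iterated directional
  derivatives up to order \<open>k\<close> exist as Frechet derivatives and are continuous.
\<close>

primrec Ck_on :: "nat \<Rightarrow> 'a::real_normed_vector set \<Rightarrow> ('a \<Rightarrow> 'b::real_normed_vector) \<Rightarrow> bool" where
  "Ck_on 0 S f \<longleftrightarrow> continuous_on S f"
| "Ck_on (Suc k) S f \<longleftrightarrow>
     (\<forall>x\<in>S. f differentiable (at x)) \<and> (\<forall>v. Ck_on k S (\<lambda>x. frechet_derivative f (at x) v))"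

definition smooth_on :: "'a::real_normed_vector set \<Rightarrow> ('a \<Rightarrow> 'b::real_normed_vector) \<Rightarrow> bool" where
  "smooth_on S f \<longleftrightarrow> (\<forall>k. Ck_on k S f)"

type_synonym ('m, 'e) atlas = "('m set \<times> ('m \<Rightarrow> 'e)) set"

text \<open>
  The manifold is the whole (Hausdorff, second countable) type \<open>'m\<close>, equipped with a smooth atlas.
  The model space is a finite-dimensional normed space rather than an instance of
  \<^class>\<open>euclidean_space\<close>, because the latter would exclude dimension 0.
\<close>

definition smooth_manifold ::
  "('m::{t2_space,second_countable_topology}, 'e::real_normed_vector) atlas \<Rightarrow> nat \<Rightarrow> bool" where
  "smooth_manifold A d \<longleftrightarrow>
     (\<exists>B :: 'e set. finite B \<and> span B = UNIV) \<and> dim (UNIV :: 'e set) = d \<and>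
     (\<Union>(U, \<phi>)\<in>A. U) = UNIV \<and>
     (\<forall>(U, \<phi>)\<in>A. open U \<and> open (\<phi> ` U) \<and> homeomorphism U (\<phi> ` U) \<phi> (inv_into U \<phi>)) \<and>
     (\<forall>(U, \<phi>)\<in>A. \<forall>(V, \<psi>)\<in>A. smooth_on (\<phi> ` (U \<inter> V)) (\<psi> \<circ> inv_into U \<phi>))"

definition smooth_fun ::
  "('m, 'e::real_normed_vector) atlas \<Rightarrow> ('m \<Rightarrow> real) \<Rightarrow> bool" where
  "smooth_fun A f \<longleftrightarrow> (\<forall>(U, \<phi>)\<in>A. smooth_on (\<phi> ` U) (f \<circ> inv_into U \<phi>))"


section \<open>Tangent vectors, vector fields and vector 1-forms\<close>

text \<open>
  A tangent vector at \<open>p\<close> is a derivation at \<open>p\<close> of the algebra of smooth functions. As HOL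
  functions are total, it is given the value 0 on all other functions, so that equality of
  derivations is equality in HOL.
\<close>

type_synonym 'm tvec = "('m \<Rightarrow> real) \<Rightarrow> real"
type_synonym 'm vfield = "'m \<Rightarrow> 'm tvec"
type_synonym 'm endo_field = "'m \<Rightarrow> 'm tvec \<Rightarrow> 'm tvec"

definition tscale :: "real \<Rightarrow> 'm tvec \<Rightarrow> 'm tvec" where
  "tscale c v = (\<lambda>f. c * v f)"

lemma vector_space_tscale: "vector_space tscale"
  by unfold_locales (auto simp: tscale_def algebra_simps)

definition tangent_space ::
  "('m, 'e::real_normed_vector) atlas \<Rightarrow> 'm \<Rightarrow> 'm tvec set" where
  "tangent_space A p = {v.
     (\<forall>f g. smooth_fun A f \<longrightarrow> smooth_fun A g \<longrightarrow> v (f + g) = v f + v g) \<and>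
     (\<forall>c f. smooth_fun A f \<longrightarrow> v (\<lambda>x. c * f x) = c * v f) \<and>
     (\<forall>f g. smooth_fun A f \<longrightarrow> smooth_fun A g \<longrightarrow> v (f * g) = f p * v g + g p * v f) \<and>
     (\<forall>f. \<not> smooth_fun A f \<longrightarrow> v f = 0)}"

definition vector_fields ::
  "('m, 'e::real_normed_vector) atlas \<Rightarrow> 'm vfield set" where
  "vector_fields A = {X. (\<forall>p. X p \<in> tangent_space A p) \<and>
     (\<forall>f. smooth_fun A f \<longrightarrow> smooth_fun A (\<lambda>p. X p f))}"

text \<open>\<open>[X,Y]f = X(Yf) - Y(Xf)\<close>; on non-smooth \<open>f\<close> this is 0, as required, for vector fields.\<close>

definition lie_bracket :: "'m vfield \<Rightarrow> 'm vfield \<Rightarrow> 'm vfield" where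
  "lie_bracket X Y = (\<lambda>p f. X p (\<lambda>q. Y q f) - Y p (\<lambda>q. X q f))"

definition act :: "'m endo_field \<Rightarrow> 'm vfield \<Rightarrow> 'm vfield"  (infixr "\<odot>" 75) where
  "K \<odot> X = (\<lambda>p. K p (X p))"

definition tlinear_on :: "'m tvec set \<Rightarrow> ('m tvec \<Rightarrow> 'm tvec) \<Rightarrow> bool" where
  "tlinear_on V F \<longleftrightarrow>
     (\<forall>v\<in>V. \<forall>w\<in>V. F (v + w) = F v + F w) \<and> (\<forall>c. \<forall>v\<in>V. F (tscale c v) = tscale c (F v))"

definition vector_1_forms ::
  "('m, 'e::real_normed_vector) atlas \<Rightarrow> 'm endo_field set" where
  "vector_1_forms A = {K.
     (\<forall>p. K p ` tangent_space A p \<subseteq> tangent_space A p \<and> tlinear_on (tangent_space A p) (K p)) \<and>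
     (\<forall>X\<in>vector_fields A. K \<odot> X \<in> vector_fields A)}"


section \<open>Froelicher--Nijenhuis brackets\<close>

text \<open>The brackets \<open>[X,K]\<close>, \<open>[K,X]\<close> and \<open>[K,N]\<close>, as operators on vector fields.\<close>

definition fn_bracket_01 :: "'m vfield \<Rightarrow> 'm endo_field \<Rightarrow> 'm vfield \<Rightarrow> 'm vfield" where
  "fn_bracket_01 X K Y = lie_bracket X (K \<odot> Y) - K \<odot> lie_bracket X Y"

definition fn_bracket_10 :: "'m endo_field \<Rightarrow> 'm vfield \<Rightarrow> 'm vfield \<Rightarrow> 'm vfield" where
  "fn_bracket_10 K X Y = - fn_bracket_01 X K Y"

definition fn_bracket_11 ::
  "'m endo_field \<Rightarrow> 'm endo_field \<Rightarrow> 'm vfield \<Rightarrow> 'm vfield \<Rightarrow> 'm vfield" where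
  "fn_bracket_11 K N X Y =
     lie_bracket (K \<odot> X) (N \<odot> Y) + lie_bracket (N \<odot> X) (K \<odot> Y)
     + K \<odot> N \<odot> lie_bracket X Y + N \<odot> K \<odot> lie_bracket X Y
     - K \<odot> lie_bracket (N \<odot> X) Y - N \<odot> lie_bracket (K \<odot> X) Y
     - K \<odot> lie_bracket X (N \<odot> Y) - N \<odot> lie_bracket X (K \<odot> Y)"


section \<open>L-connections\<close>

definition vertical_space ::
  "('m, 'e::real_normed_vector) atlas \<Rightarrow> 'm endo_field \<Rightarrow> 'm \<Rightarrow> 'm tvec set" where
  "vertical_space A L p = L p ` tangent_space A p"

definition L_structure ::
  "('m, 'e::real_normed_vector) atlas \<Rightarrow> nat \<Rightarrow> 'm endo_field \<Rightarrow> 'm vfield \<Rightarrow> bool" where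
  "L_structure A n L C \<longleftrightarrow>
     L \<in> vector_1_forms A \<and>
     (\<forall>p. vector_space.dim tscale (L p ` tangent_space A p) = n) \<and>
     (\<forall>X\<in>vector_fields A. \<forall>Y\<in>vector_fields A. fn_bracket_11 L L X Y = 0) \<and>
     (\<forall>p. L p ` tangent_space A p = {v \<in> tangent_space A p. L p v = 0}) \<and>
     C \<in> vector_fields A \<and> (\<forall>p. C p \<in> vertical_space A L p) \<and>
     (\<forall>X\<in>vector_fields A. fn_bracket_01 C L X = - (L \<odot> X))"

definition L_connection ::
  "('m, 'e::real_normed_vector) atlas \<Rightarrow> 'm endo_field \<Rightarrow> 'm endo_field \<Rightarrow> bool" where
  "L_connection A L \<Gamma> \<longleftrightarrow> \<Gamma> \<in> vector_1_forms A \<and>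
     (\<forall>p. \<forall>v\<in>tangent_space A p. L p (\<Gamma> p v) = L p v \<and> \<Gamma> p (L p v) = - L p v)"

definition hproj :: "'m endo_field \<Rightarrow> 'm endo_field" where
  "hproj \<Gamma> = (\<lambda>p v. tscale (1/2) (v + \<Gamma> p v))"

definition conn_curvature :: "'m endo_field \<Rightarrow> 'm vfield \<Rightarrow> 'm vfield \<Rightarrow> 'm vfield" where
  "conn_curvature \<Gamma> X Y = (\<lambda>p. tscale (-1/2) (fn_bracket_11 (hproj \<Gamma>) (hproj \<Gamma>) X Y p))"

definition homogeneous ::
  "('m, 'e::real_normed_vector) atlas \<Rightarrow> 'm vfield \<Rightarrow> 'm endo_field \<Rightarrow> bool" where
  "homogeneous A C \<Gamma> \<longleftrightarrow> (\<forall>X\<in>vector_fields A. fn_bracket_01 C \<Gamma> X = 0)"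

definition L_spray ::
  "('m, 'e::real_normed_vector) atlas \<Rightarrow> 'm endo_field \<Rightarrow> 'm vfield \<Rightarrow> 'm vfield \<Rightarrow> bool" where
  "L_spray A L C S \<longleftrightarrow> S \<in> vector_fields A \<and> L \<odot> S = C \<and> lie_bracket C S = S"

definition conservative ::
  "('m, 'e::real_normed_vector) atlas \<Rightarrow> 'm endo_field \<Rightarrow> 'm vfield \<Rightarrow> 'm endo_field \<Rightarrow> bool" where
  "conservative A L C \<Gamma> \<longleftrightarrow> L_connection A L \<Gamma> \<and> homogeneous A C \<Gamma> \<and>
     (\<exists>S. L_spray A L C S \<and> (\<forall>X\<in>vector_fields A. \<Gamma> \<odot> X = fn_bracket_10 L S X))"


section \<open>Linear connections and lifts\<close>

text \<open>
  \<open>D p v Y\<close> is the covariant derivative at \<open>p\<close> of the vector field \<open>Y\<close> along the tangent vector \<open>v\<close>;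
  \<open>cov D X Y\<close> is the vector field \<open>D\<^sub>X Y\<close>.
\<close>

type_synonym 'm connection = "'m \<Rightarrow> 'm tvec \<Rightarrow> 'm vfield \<Rightarrow> 'm tvec"

definition cov :: "'m connection \<Rightarrow> 'm vfield \<Rightarrow> 'm vfield \<Rightarrow> 'm vfield" where
  "cov D X Y = (\<lambda>p. D p (X p) Y)"

definition linear_connection ::
  "('m, 'e::real_normed_vector) atlas \<Rightarrow> 'm connection \<Rightarrow> bool" where
  "linear_connection A D \<longleftrightarrow>
     (\<forall>p. \<forall>v\<in>tangent_space A p. \<forall>Y\<in>vector_fields A. D p v Y \<in> tangent_space A p) \<and>
     (\<forall>p. \<forall>Y\<in>vector_fields A. tlinear_on (tangent_space A p) (\<lambda>v. D p v Y)) \<and>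
     (\<forall>p. \<forall>v\<in>tangent_space A p. \<forall>Y\<in>vector_fields A. \<forall>Z\<in>vector_fields A.
        D p v (Y + Z) = D p v Y + D p v Z) \<and>
     (\<forall>p. \<forall>v\<in>tangent_space A p. \<forall>Y\<in>vector_fields A. \<forall>f. smooth_fun A f \<longrightarrow>
        D p v (\<lambda>q. tscale (f q) (Y q)) = tscale (v f) (Y p) + tscale (f p) (D p v Y)) \<and>
     (\<forall>X\<in>vector_fields A. \<forall>Y\<in>vector_fields A. cov D X Y \<in> vector_fields A)"

definition L_almost_tangent ::
  "('m, 'e::real_normed_vector) atlas \<Rightarrow> 'm endo_field \<Rightarrow> 'm connection \<Rightarrow> bool" where
  "L_almost_tangent A L D \<longleftrightarrow> linear_connection A D \<and>
     (\<forall>X\<in>vector_fields A. \<forall>Y\<in>vector_fields A. cov D X (L \<odot> Y) = L \<odot> cov D X Y)"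

definition K_map :: "'m connection \<Rightarrow> 'm vfield \<Rightarrow> 'm endo_field" where
  "K_map D C = (\<lambda>p v. D p v C)"

definition L_regular ::
  "('m, 'e::real_normed_vector) atlas \<Rightarrow> 'm endo_field \<Rightarrow> 'm vfield \<Rightarrow> 'm connection \<Rightarrow> bool" where
  "L_regular A L C D \<longleftrightarrow> L_almost_tangent A L D \<and>
     (\<forall>p. bij_betw (K_map D C p) (vertical_space A L p) (vertical_space A L p))"

text \<open>\<open>\<Gamma> = I - 2\<phi> \<circ> K\<close>, where \<open>\<phi>\<close> inverts the restriction of \<open>K\<close> to the vertical bundle.\<close>

definition induces ::
  "('m, 'e::real_normed_vector) atlas \<Rightarrow> 'm endo_field \<Rightarrow> 'm vfield \<Rightarrow> 'm connection \<Rightarrow>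
   'm endo_field \<Rightarrow> bool" where
  "induces A L C D \<Gamma> \<longleftrightarrow> L_regular A L C D \<and>
     (\<forall>p. \<forall>v\<in>tangent_space A p.
        \<Gamma> p v = v - tscale 2 (inv_into (vertical_space A L p) (K_map D C p) (K_map D C p v)))"

definition L_normal ::
  "('m, 'e::real_normed_vector) atlas \<Rightarrow> 'm endo_field \<Rightarrow> 'm vfield \<Rightarrow> 'm connection \<Rightarrow> bool" where
  "L_normal A L C D \<longleftrightarrow> L_almost_tangent A L D \<and>
     (\<forall>X\<in>vector_fields A. cov D (L \<odot> X) C = L \<odot> X)"

definition L_lift ::
  "('m, 'e::real_normed_vector) atlas \<Rightarrow> 'm endo_field \<Rightarrow> 'm vfield \<Rightarrow> 'm endo_field \<Rightarrow>
   'm connection \<Rightarrow> bool" where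
  "L_lift A L C \<Gamma> D \<longleftrightarrow> L_normal A L C D \<and> induces A L C D \<Gamma>"

text \<open>Vanishing of \<open>(D\<^sub>X \<Gamma>) Y = D\<^sub>X (\<Gamma> Y) - \<Gamma> (D\<^sub>X Y)\<close>.\<close>

definition reducible_L_lift ::
  "('m, 'e::real_normed_vector) atlas \<Rightarrow> 'm endo_field \<Rightarrow> 'm vfield \<Rightarrow> 'm endo_field \<Rightarrow>
   'm connection \<Rightarrow> bool" where
  "reducible_L_lift A L C \<Gamma> D \<longleftrightarrow> L_lift A L C \<Gamma> D \<and>
     (\<forall>X\<in>vector_fields A. \<forall>Y\<in>vector_fields A. cov D X (\<Gamma> \<odot> Y) - \<Gamma> \<odot> cov D X Y = 0)"

definition torsion :: "'m connection \<Rightarrow> 'm vfield \<Rightarrow> 'm vfield \<Rightarrow> 'm vfield" where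
  "torsion D X Y = cov D X Y - cov D Y X - lie_bracket X Y"

definition curvature :: "'m connection \<Rightarrow> 'm vfield \<Rightarrow> 'm vfield \<Rightarrow> 'm vfield \<Rightarrow> 'm vfield" where
  "curvature D X Y Z = cov D X (cov D Y Z) - cov D Y (cov D X Z) - cov D (lie_bracket X Y) Z"

text \<open>
  For homogeneous \<open>\<Gamma>\<close> exactly one linear connection has these properties (up to the irrelevant values
  of \<open>D p v Y\<close> for \<open>v\<close> not tangent at \<open>p\<close> or \<open>Y\<close> not a vector field).
\<close>

definition Berwald_L_lift ::
  "('m, 'e::real_normed_vector) atlas \<Rightarrow> 'm endo_field \<Rightarrow> 'm vfield \<Rightarrow> 'm endo_field \<Rightarrow>
   'm connection \<Rightarrow> bool" where
  "Berwald_L_lift A L C \<Gamma> D \<longleftrightarrow> reducible_L_lift A L C \<Gamma> D \<and>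
     (\<forall>X\<in>vector_fields A. \<forall>Y\<in>vector_fields A. torsion D (L \<odot> X) Y = 0)"

definition hh_curvature ::
  "'m endo_field \<Rightarrow> 'm endo_field \<Rightarrow> 'm connection \<Rightarrow>
   'm vfield \<Rightarrow> 'm vfield \<Rightarrow> 'm vfield \<Rightarrow> 'm vfield" where
  "hh_curvature L \<Gamma> D X Y Z = curvature D (hproj \<Gamma> \<odot> X) (hproj \<Gamma> \<odot> Y) (L \<odot> Z)"

text \<open>Covariant derivatives of vector-valued and of endomorphism-valued 2-forms.\<close>

definition cov_2form ::
  "'m connection \<Rightarrow> 'm vfield \<Rightarrow> ('m vfield \<Rightarrow> 'm vfield \<Rightarrow> 'm vfield) \<Rightarrow>
   'm vfield \<Rightarrow> 'm vfield \<Rightarrow> 'm vfield" where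
  "cov_2form D W \<omega> X Y = cov D W (\<omega> X Y) - \<omega> (cov D W X) Y - \<omega> X (cov D W Y)"

definition cov_End_2form ::
  "'m connection \<Rightarrow> 'm vfield \<Rightarrow> ('m vfield \<Rightarrow> 'm vfield \<Rightarrow> 'm vfield \<Rightarrow> 'm vfield) \<Rightarrow>
   'm vfield \<Rightarrow> 'm vfield \<Rightarrow> 'm vfield \<Rightarrow> 'm vfield" where
  "cov_End_2form D U R X Y W =
     cov D U (R X Y W) - R (cov D U X) Y W - R X (cov D U Y) W - R X Y (cov D U W)"

definition cyclic_sum ::
  "('m vfield \<Rightarrow> 'm vfield \<Rightarrow> 'm vfield \<Rightarrow> 'm vfield) \<Rightarrow>
   'm vfield \<Rightarrow> 'm vfield \<Rightarrow> 'm vfield \<Rightarrow> 'm vfield" where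
  "cyclic_sum F X Y Z = F X Y Z + F Y Z X + F Z X Y"

end

theory Submission
  imports Defs
begin

text \<open>
  The Berwald lift \<open>D\<close> satisfies \<open>DL = 0\<close>, \<open>Dh = 0\<close>, and since \<open>\<Gamma> = [L,S]\<close> gives \<open>[L,\<Gamma>] = 0\<close>, its
  torsion is exactly \<open>\<Omega>\<close>. The first Bianchi identity \<open>\<SS> \<^bold>R(X,Y)Z = \<SS> (D\<^sub>X\<Omega>)(Y,Z)\<close> has a horizontal
  and a vertical part. On horizontal fields both sides vanish separately, which is (a) and
  \<open>\<SS> R(X,Y)Z = 0\<close>. On \<open>LX, hY, hZ\<close> it gives \<open>R(Y,Z)X = (D\<^sub>L\<^sub>X\<Omega>)(Y,Z)\<close>, hence (b), and on \<open>LX, LY, hZ\<close> it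
  gives \<open>\<^bold>R(LX,LY) = 0\<close>. So the second derivative of \<open>\<Omega>\<close> along vertical fields is symmetric, and (c) is
  a derivative of (b). All of this is additive algebra with vector fields; multiplication by
  functions is never needed.
\<close>

section \<open>Additive maps on a subgroup\<close>

text \<open>Vector fields are only a subset of their HOL type, so the algebra is done relative to a
  carrier \<open>V\<close> and additivity is asked for on \<open>V\<close> alone.\<close>

locale subgroup_of =
  fixes V :: "'a::ab_group_add set"
  assumes zero_in [simp]: "0 \<in> V"
    and add_in [simp]: "X \<in> V \<Longrightarrow> Y \<in> V \<Longrightarrow> X + Y \<in> V"
    and uminus_in [simp]: "X \<in> V \<Longrightarrow> - X \<in> V"
begin

lemma diff_in [simp]: "X \<in> V \<Longrightarrow> Y \<in> V \<Longrightarrow> X - Y \<in> V"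
  using add_in[of X "- Y"] by simp

definition additive_on :: "('a \<Rightarrow> 'b::ab_group_add) \<Rightarrow> bool" where
  "additive_on F \<longleftrightarrow> (\<forall>X\<in>V. \<forall>Y\<in>V. F (X + Y) = F X + F Y)"

lemma additive_on:
  assumes "additive_on F" and "X \<in> V"
  shows additive_on_add: "Y \<in> V \<Longrightarrow> F (X + Y) = F X + F Y"
    and additive_on_zero: "F 0 = 0"
    and additive_on_uminus: "F (- X) = - F X"
    and additive_on_diff: "Y \<in> V \<Longrightarrow> F (X - Y) = F X - F Y"
proof -
  have a: "F (X + Y) = F X + F Y" if "X \<in> V" "Y \<in> V" for X Y
    using assms that by (simp add: additive_on_def)
  show "F (X + Y) = F X + F Y" if "Y \<in> V" using a assms that by blast
  show z: "F 0 = 0" using a[of 0 0] by simp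
  have u: "F (- Y) = - F Y" if "Y \<in> V" for Y
    using a[of Y "- Y"] that z by (simp add: eq_neg_iff_add_eq_0 add.commute)
  then show "F (- X) = - F X" using assms by blast
  show "F (X - Y) = F X - F Y" if "Y \<in> V"
    using a[of X "- Y"] u[of Y] assms that by simp
qed

end

section \<open>Bianchi identities of the Berwald lift\<close>

text \<open>\<open>br_anti\<close> has no membership premises because \<open>lie_bracket\<close> is
  antisymmetric on arbitrary functions; additivity and Jacobi need genuine derivations.\<close>

locale lie_ring_on = subgroup_of V for V :: "'a::ab_group_add set" +
  fixes br :: "'a \<Rightarrow> 'a \<Rightarrow> 'a"
  assumes br_in [simp]: "X \<in> V \<Longrightarrow> Y \<in> V \<Longrightarrow> br X Y \<in> V"
    and br_add_left: "X \<in> V \<Longrightarrow> Y \<in> V \<Longrightarrow> Z \<in> V \<Longrightarrow> br (X + Y) Z = br X Z + br Y Z"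
    and br_anti: "br X Y = - br Y X"
    and jacobi: "X \<in> V \<Longrightarrow> Y \<in> V \<Longrightarrow> Z \<in> V \<Longrightarrow> br X (br Y Z) + br Y (br Z X) + br Z (br X Y) = 0"
begin

lemma additive_on_br_left: "Z \<in> V \<Longrightarrow> additive_on (\<lambda>X. br X Z)"
  by (simp add: additive_on_def br_add_left)

lemma additive_on_br_right: "Z \<in> V \<Longrightarrow> additive_on (br Z)"
  unfolding additive_on_def using br_add_left br_anti by (metis minus_add_distrib)

lemmas br_simps =
  additive_on_add[OF additive_on_br_left] additive_on_diff[OF additive_on_br_left]
  additive_on_uminus[OF additive_on_br_left]
  additive_on_add[OF additive_on_br_right] additive_on_diff[OF additive_on_br_right]
  additive_on_uminus[OF additive_on_br_right]

lemma br_zero [simp]: "X \<in> V \<Longrightarrow> br 0 X = 0" "X \<in> V \<Longrightarrow> br X 0 = 0"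
  using additive_on_zero[OF additive_on_br_left] additive_on_zero[OF additive_on_br_right] by blast+

text \<open>Jacobi as a derivation rule for bracketing with \<open>S\<close>, the form used in
  \<open>fn_bracket_spray\<close>.\<close>

lemma br_leibniz:
  assumes "X \<in> V" "Y \<in> V" "S \<in> V"
  shows "br (br X Y) S = br (br X S) Y + br X (br Y S)"
proof -
  have "br X (br Y S) + br Y (br S X) + br S (br X Y) = 0" using jacobi assms by blast
  moreover have "br Y (br S X) = br (br X S) Y"
    using assms br_anti[of Y "br S X"] br_anti[of S X] additive_on_uminus[OF additive_on_br_left]
    by (metis br_in minus_minus)
  moreover have "br S (br X Y) = - br (br X Y) S" by (rule br_anti)
  ultimately show ?thesis by (simp add: algebra_simps)
qed

text \<open>The Froelicher--Nijenhuis identity \<open>[L,[L,S]] = 0\<close> comes from applying \<open>[\<cdot>, S]\<close> to \<open>[L,L] = 0\<close>.\<close>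

lemma fn_bracket_spray:
  assumes L: "additive_on L" "\<And>X. X \<in> V \<Longrightarrow> L X \<in> V" "\<And>X. X \<in> V \<Longrightarrow> L (L X) = 0"
    and N: "\<And>X Y. X \<in> V \<Longrightarrow> Y \<in> V \<Longrightarrow> br (L X) (L Y) = L (br (L X) Y) + L (br X (L Y))"
    and G: "\<And>X. X \<in> V \<Longrightarrow> G X = br (L X) S - L (br X S)"
    and S: "S \<in> V" and X: "X \<in> V" and Y: "Y \<in> V"
  shows "br (L X) (G Y) + br (G X) (L Y)
    = L (br (G X) Y) + G (br (L X) Y) + L (br X (G Y)) + G (br X (L Y))"
proof -
  note s = additive_on_add[OF L(1)] additive_on_diff[OF L(1)] L(2,3) X Y S br_simps
  have "br (br (L X) (L Y)) S = br (L (br (L X) Y)) S + br (L (br X (L Y))) S"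
    by (simp add: N s)
  then have "br (br (L X) S) (L Y) + br (L X) (br (L Y) S)
      = br (L (br (L X) Y)) S + br (L (br X (L Y))) S"
    using br_leibniz[of "L X" "L Y" S] by (simp add: s)
  \<comment> \<open>Unfolding \<open>G\<close> in the goal produces brackets of
    \<open>L (br X S)\<close> and \<open>L (br Y S)\<close>; \<open>N\<close> expands these, with
    \<open>L (L _) = 0\<close>.\<close>
  moreover have "br (L (br X S)) (L Y) = L (br (L (br X S)) Y) + L (br (br X S) (L Y))"
    and "br (L X) (L (br Y S)) = L (br (L X) (br Y S)) + L (br X (L (br Y S)))"
    by (simp_all add: N s)
  \<comment> \<open>These terms come from \<open>G\<close> on the right-hand side. Leibniz splits
    each into one term of the two previous equations and one part of \<open>L (br (G X) Y)\<close>
    or \<open>L (br X (G Y))\<close>.\<close>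
  moreover have "L (br (br (L X) Y) S) = L (br (br (L X) S) Y) + L (br (L X) (br Y S))"
    and "L (br (br X (L Y)) S) = L (br (br X S) (L Y)) + L (br X (br (L Y) S))"
    using br_leibniz[of "L X" Y S] br_leibniz[of X "L Y" S] by (simp_all add: s)
  ultimately show ?thesis by (simp add: G s algebra_simps)
qed

end

text \<open>What the Bianchi argument uses of the geometry: \<open>L_exact\<close> is
  \<open>Ker L = Im L\<close> on fields, \<open>L_torsion\<close> is \<open>[L,h] = 0\<close>
  evaluated on \<open>h X\<close>, \<open>h Y\<close>, and \<open>D_L\<close>, \<open>D_h\<close>
  say that \<open>L\<close> and \<open>h\<close> are parallel.\<close>

locale berwald = lie_ring_on V br
  for V :: "'a::ab_group_add set" and br :: "'a \<Rightarrow> 'a \<Rightarrow> 'a" +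
  fixes L h :: "'a \<Rightarrow> 'a" and D :: "'a \<Rightarrow> 'a \<Rightarrow> 'a"
  assumes additive_on_L: "additive_on L" and L_in [simp]: "X \<in> V \<Longrightarrow> L X \<in> V"
    and additive_on_h: "additive_on h" and h_in [simp]: "X \<in> V \<Longrightarrow> h X \<in> V"
    and L_h [simp]: "X \<in> V \<Longrightarrow> L (h X) = L X"
    and h_L [simp]: "X \<in> V \<Longrightarrow> h (L X) = 0"
    and h_h [simp]: "X \<in> V \<Longrightarrow> h (h X) = h X"
    and L_exact: "X \<in> V \<Longrightarrow> L X = 0 \<Longrightarrow> \<exists>Y\<in>V. X = L Y"
    and L_torsion: "X \<in> V \<Longrightarrow> Y \<in> V \<Longrightarrow>
      br (L X) (h Y) + br (h X) (L Y) = L (br (h X) (h Y)) + h (br (L X) (h Y)) + h (br (h X) (L Y))"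
    and additive_on_D_left: "Y \<in> V \<Longrightarrow> additive_on (\<lambda>X. D X Y)"
    and additive_on_D_right: "X \<in> V \<Longrightarrow> additive_on (D X)"
    and D_in [simp]: "X \<in> V \<Longrightarrow> Y \<in> V \<Longrightarrow> D X Y \<in> V"
    and D_L: "X \<in> V \<Longrightarrow> Y \<in> V \<Longrightarrow> D X (L Y) = L (D X Y)"
    and D_h: "X \<in> V \<Longrightarrow> Y \<in> V \<Longrightarrow> D X (h Y) = h (D X Y)"
    and torsion_L: "X \<in> V \<Longrightarrow> Y \<in> V \<Longrightarrow> D (L X) Y - D Y (L X) - br (L X) Y = 0"
begin

lemmas L_simps = additive_on_add[OF additive_on_L] additive_on_diff[OF additive_on_L]
  additive_on_uminus[OF additive_on_L]
lemmas h_simps = additive_on_add[OF additive_on_h] additive_on_diff[OF additive_on_h]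
  additive_on_uminus[OF additive_on_h]
lemmas D_simps = additive_on_add[OF additive_on_D_left] additive_on_diff[OF additive_on_D_left]
  additive_on_uminus[OF additive_on_D_left]
  additive_on_add[OF additive_on_D_right] additive_on_diff[OF additive_on_D_right]
  additive_on_uminus[OF additive_on_D_right]

lemma zero_simps [simp]: "L 0 = 0" "h 0 = 0" "X \<in> V \<Longrightarrow> D 0 X = 0" "X \<in> V \<Longrightarrow> D X 0 = 0"
  using additive_on_zero[OF additive_on_L] additive_on_zero[OF additive_on_h]
    additive_on_zero[OF additive_on_D_left] additive_on_zero[OF additive_on_D_right]
  by (blast intro: zero_in)+

lemma L_L [simp]: "X \<in> V \<Longrightarrow> L (L X) = 0"
  using L_h[of "L X"] by simp

text \<open>\<open>X - h X\<close> lies in the kernel of \<open>L\<close>, so exactness applies.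
  Additive claims can then be checked on horizontal and vertical arguments separately.\<close>

lemma horizontal_decomp:
  assumes "X \<in> V"
  obtains X' where "X' \<in> V" "X = h X + L X'"
proof -
  have "L (X - h X) = 0" using assms by (simp add: L_simps)
  then obtain X' where "X' \<in> V" "X - h X = L X'" using L_exact assms by (metis diff_in h_in)
  then show thesis using that by (metis add.commute diff_add_cancel)
qed

section \<open>Torsion: verticality and the link with the bracket of horizontal fields\<close>

definition tors :: "'a \<Rightarrow> 'a \<Rightarrow> 'a" where
  "tors X Y = D X Y - D Y X - br X Y"

definition curv :: "'a \<Rightarrow> 'a \<Rightarrow> 'a \<Rightarrow> 'a" where
  "curv X Y Z = D X (D Y Z) - D Y (D X Z) - D (br X Y) Z"

definition Dtors :: "'a \<Rightarrow> 'a \<Rightarrow> 'a \<Rightarrow> 'a" where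
  "Dtors W X Y = D W (tors X Y) - tors (D W X) Y - tors X (D W Y)"

lemma tors_in [simp]: "X \<in> V \<Longrightarrow> Y \<in> V \<Longrightarrow> tors X Y \<in> V"
  by (simp add: tors_def)

lemma curv_in [simp]: "X \<in> V \<Longrightarrow> Y \<in> V \<Longrightarrow> Z \<in> V \<Longrightarrow> curv X Y Z \<in> V"
  by (simp add: curv_def)

lemma Dtors_in [simp]: "X \<in> V \<Longrightarrow> Y \<in> V \<Longrightarrow> W \<in> V \<Longrightarrow> Dtors W X Y \<in> V"
  by (simp add: Dtors_def)

lemma tors_anti: "tors X Y = - tors Y X"
  using br_anti[of X Y] by (simp add: tors_def)

lemma additive_on_tors_left: "Y \<in> V \<Longrightarrow> additive_on (\<lambda>X. tors X Y)"
  by (simp add: additive_on_def tors_def D_simps br_simps algebra_simps)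

lemma additive_on_tors_right: "X \<in> V \<Longrightarrow> additive_on (tors X)"
  by (simp add: additive_on_def tors_def D_simps br_simps algebra_simps)

lemmas tors_simps = 
  additive_on_add[OF additive_on_tors_left] additive_on_diff[OF additive_on_tors_left]
  additive_on_add[OF additive_on_tors_right] additive_on_diff[OF additive_on_tors_right]

lemma tors_zero [simp]: "X \<in> V \<Longrightarrow> tors 0 X = 0" "X \<in> V \<Longrightarrow> tors X 0 = 0"
  by (simp_all add: tors_def)

lemma tors_L [simp]: "X \<in> V \<Longrightarrow> Y \<in> V \<Longrightarrow> tors (L X) Y = 0" "X \<in> V \<Longrightarrow> Y \<in> V \<Longrightarrow> tors Y (L X) = 0"
proof -
  show "tors (L X) Y = 0" if "X \<in> V" "Y \<in> V" for X Y using torsion_L that by (simp add: tors_def)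
  then show "X \<in> V \<Longrightarrow> Y \<in> V \<Longrightarrow> tors Y (L X) = 0" using tors_anti[of Y "L X"] by simp
qed

lemma tors_h:
  assumes "X \<in> V" "Y \<in> V"
  shows "tors X Y = tors (h X) (h Y)"
proof -
  obtain X' Y' where d: "X' \<in> V" "X = h X + L X'" "Y' \<in> V" "Y = h Y + L Y'"
    using assms horizontal_decomp by metis
  have "tors X Y = tors (h X + L X') (h Y + L Y')" by (simp flip: d(2,4))
  also have "\<dots> = tors (h X) (h Y)" using d(1,3) assms by (simp add: tors_simps)
  finally show ?thesis .
qed

lemma tors_h_left [simp]: "X \<in> V \<Longrightarrow> Y \<in> V \<Longrightarrow> tors (h X) Y = tors X Y"
  and tors_h_right [simp]: "X \<in> V \<Longrightarrow> Y \<in> V \<Longrightarrow> tors X (h Y) = tors X Y"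
  using tors_h[of "h X" Y] tors_h[of X "h Y"] tors_h[of X Y] by simp_all

text \<open>Apply \<open>h\<close> to the vanishing torsion of \<open>L Y\<close> and
  \<open>h X\<close>: it annihilates \<open>D (h X) (L Y)\<close> and fixes
  \<open>D (L Y) (h X)\<close>. This determines the latter, and the torsion equation then gives the
  former.\<close>

lemma D_h_L:
  assumes "X \<in> V" "Y \<in> V"
  shows "D (h X) (L Y) = br (h X) (L Y) - h (br (h X) (L Y))"
proof -
  have t: "D (L Y) (h X) - D (h X) (L Y) - br (L Y) (h X) = 0" using torsion_L assms by simp
  then have "h (D (L Y) (h X) - D (h X) (L Y) - br (L Y) (h X)) = 0" by simp
  then have "D (L Y) (h X) = h (br (L Y) (h X))"
    using assms by (simp add: h_simps D_h D_L)
  with t have "D (h X) (L Y) = h (br (L Y) (h X)) - br (L Y) (h X)"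
    by (simp add: algebra_simps)
  then show ?thesis
    using assms br_anti[of "L Y" "h X"] by (simp add: h_simps)
qed

text \<open>As \<open>L\<close> is parallel, \<open>L\<close> of the torsion involves only
  derivatives of vertical fields, which \<open>D_h_L\<close> computes; \<open>L_torsion\<close>
  makes the result zero. So the torsion is vertical, and \<open>h\<close> kills it.\<close>

lemma h_tors [simp]:
  assumes "X \<in> V" "Y \<in> V"
  shows "h (tors X Y) = 0"
proof -
  have "L (tors (h X) (h Y)) = D (h X) (L Y) - D (h Y) (L X) - L (br (h X) (h Y))"
    using assms by (simp add: tors_def L_simps flip: D_L del: tors_h_left tors_h_right)
  also have "\<dots> = 0"
    using L_torsion[OF assms] br_anti[of "h Y" "L X"] assms
    by (simp add: D_h_L h_simps algebra_simps)
  finally have "L (tors X Y) = 0" using assms by simp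
  then show ?thesis using L_exact assms by (metis h_L tors_in)
qed

text \<open>The derivatives in the torsion of \<open>h X\<close>, \<open>h Y\<close> are horizontal
  while the torsion is vertical, so only minus the vertical part of the bracket survives.\<close>

lemma tors_eq:
  assumes "X \<in> V" "Y \<in> V"
  shows "tors X Y = h (br (h X) (h Y)) - br (h X) (h Y)"
proof -
  have t: "tors X Y = D (h X) (h Y) - D (h Y) (h X) - br (h X) (h Y)"
    using tors_h[OF assms] by (simp add: tors_def)
  then have "h (D (h X) (h Y) - D (h Y) (h X) - br (h X) (h Y)) = 0" using h_tors[OF assms] by simp
  then have "h (br (h X) (h Y)) = D (h X) (h Y) - D (h Y) (h X)"
    using assms by (simp add: h_simps D_h)
  then show ?thesis using t by simp
qed

text \<open>Without torsion the bracket is a difference of derivatives of vertical fields, and these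
  stay vertical because \<open>L\<close> is parallel.\<close>

lemma h_br_L_L:
  assumes "X \<in> V" "Y \<in> V"
  shows "h (br (L X) (L Y)) = 0"
proof -
  have "br (L X) (L Y) = D (L X) (L Y) - D (L Y) (L X)"
    using torsion_L[of X "L Y"] assms by (simp add: algebra_simps)
  then show ?thesis using assms by (simp add: h_simps D_L)
qed

text \<open>The torsion is the curvature \<open>-1/2 [h,h]\<close> of the connection.\<close>

lemma tors_add_tors:
  assumes "X \<in> V" "Y \<in> V"
  shows "tors X Y + tors X Y =
    - (br (h X) (h Y) + br (h X) (h Y) + h (h (br X Y)) + h (h (br X Y))
      - h (br (h X) Y) - h (br (h X) Y) - h (br X (h Y)) - h (br X (h Y)))"
proof -
  obtain X' Y' where d: "X' \<in> V" "X = h X + L X'" "Y' \<in> V" "Y = h Y + L Y'"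
    using assms horizontal_decomp by metis
  \<comment> \<open>Both arguments are vertical, so their bracket is too; expanding it expresses
    \<open>h (br X Y)\<close> by brackets with projected arguments.\<close>
  then have "h (br (X - h X) (Y - h Y)) = 0"
    using h_br_L_L by (metis add_diff_cancel_left')
  then have "h (br X Y) + h (br (h X) (h Y)) = h (br X (h Y)) + h (br (h X) Y)"
    using assms by (simp add: br_simps h_simps algebra_simps)
  \<comment> \<open>The identity is added to itself because \<open>[h,h]\<close> contains every term
    twice and the abstract group has no factor 1/2.\<close>
  from arg_cong2[where f = plus, OF this this] show ?thesis
    using assms by (simp add: tors_eq algebra_simps)
qed

text \<open>Torsion values are vertical and the torsion ignores vertical arguments. This removes the
  quadratic torsion term from the first Bianchi identity.\<close>

lemma tors_tors [simp]:
  assumes "X \<in> V" "Y \<in> V" "Z \<in> V"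
  shows "tors (tors X Y) Z = 0"
  using tors_h_left[of "tors X Y" Z] assms by simp

lemma h_Dtors [simp]: "X \<in> V \<Longrightarrow> Y \<in> V \<Longrightarrow> W \<in> V \<Longrightarrow> h (Dtors W X Y) = 0"
  by (simp add: Dtors_def h_simps flip: D_h)

lemma Dtors_h [simp]:
  "X \<in> V \<Longrightarrow> Y \<in> V \<Longrightarrow> W \<in> V \<Longrightarrow> Dtors W (h X) Y = Dtors W X Y"
  "X \<in> V \<Longrightarrow> Y \<in> V \<Longrightarrow> W \<in> V \<Longrightarrow> Dtors W X (h Y) = Dtors W X Y"
  by (simp_all add: Dtors_def D_h)

lemma Dtors_L [simp]:
  "X \<in> V \<Longrightarrow> Y \<in> V \<Longrightarrow> W \<in> V \<Longrightarrow> Dtors W (L X) Y = 0"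
  "X \<in> V \<Longrightarrow> Y \<in> V \<Longrightarrow> W \<in> V \<Longrightarrow> Dtors W X (L Y) = 0"
  by (simp_all add: Dtors_def D_L)

section \<open>Curvature and the first Bianchi identity\<close>

lemma curv_L: "X \<in> V \<Longrightarrow> Y \<in> V \<Longrightarrow> Z \<in> V \<Longrightarrow> curv X Y (L Z) = L (curv X Y Z)"
  by (simp add: curv_def D_L L_simps)

lemma curv_h: "X \<in> V \<Longrightarrow> Y \<in> V \<Longrightarrow> Z \<in> V \<Longrightarrow> curv X Y (h Z) = h (curv X Y Z)"
  by (simp add: curv_def D_h h_simps)

text \<open>Group the second derivatives into derivatives of torsions plus terms pairing a field
  with a bracket. In the latter, \<open>tors_tors\<close> allows \<open>br Y Z\<close> to be
  replaced by \<open>D Y Z - D Z Y\<close> inside the torsion, and the double brackets cancel by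
  Jacobi.\<close>

lemma bianchi1:
  assumes "X \<in> V" "Y \<in> V" "Z \<in> V"
  shows "curv X Y Z + curv Y Z X + curv Z X Y = Dtors X Y Z + Dtors Y Z X + Dtors Z X Y"
proof -
  have a: "curv X Y Z + curv Y Z X + curv Z X Y =
      D X (tors Y Z) + D Y (tors Z X) + D Z (tors X Y)
      + (D X (br Y Z) - D (br Y Z) X) + (D Y (br Z X) - D (br Z X) Y) + (D Z (br X Y) - D (br X Y) Z)"
    using assms by (simp add: curv_def tors_def D_simps algebra_simps)
  have b: "D X (br Y Z) - D (br Y Z) X = tors X (D Y Z) - tors X (D Z Y) + br X (br Y Z)"
    if "X \<in> V" "Y \<in> V" "Z \<in> V" for X Y Z
  proof -
    have "tors X (tors Y Z) = 0" using that tors_anti[of X "tors Y Z"] by simp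
    then have "tors X (D Y Z) - tors X (D Z Y) = tors X (br Y Z)"
      using that by (simp add: tors_def[of Y Z] tors_simps)
    then show ?thesis by (simp add: tors_def)
  qed
  show ?thesis
    unfolding a b[OF assms] b[OF assms(2,3,1)] b[OF assms(3,1,2)] Dtors_def
    using jacobi[OF assms] tors_anti[of X "D Y Z"] tors_anti[of Y "D Z X"] tors_anti[of Z "D X Y"]
    by (simp add: algebra_simps)
qed

text \<open>In \<open>bianchi1\<close> on horizontal fields the curvature side is horizontal and the
  torsion side vertical, so both vanish.\<close>

lemma cyclic_curv:
  assumes "X \<in> V" "Y \<in> V" "Z \<in> V"
  shows "curv (h X) (h Y) (h Z) + curv (h Y) (h Z) (h X) + curv (h Z) (h X) (h Y) = 0"
proof -
  have "h (curv (h X) (h Y) (h Z) + curv (h Y) (h Z) (h X) + curv (h Z) (h X) (h Y)) = 0"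
    using assms by (subst bianchi1) (simp_all add: h_simps)
  then show ?thesis using assms by (simp add: h_simps curv_h)
qed

theorem cyclic_Dtors_h:
  assumes "X \<in> V" "Y \<in> V" "Z \<in> V"
  shows "Dtors (h X) Y Z + Dtors (h Y) Z X + Dtors (h Z) X Y = 0"
  using bianchi1[of "h X" "h Y" "h Z"] cyclic_curv[OF assms] assms by simp

text \<open>Vertical part of the first Bianchi identity for \<open>LX, hY, hZ\<close>.\<close>

lemma curv_eq_Dtors:
  assumes "X \<in> V" "Y \<in> V" "Z \<in> V"
  shows "curv (h Y) (h Z) (L X) = Dtors (L X) Y Z"
proof -
  have b: "curv (L X) (h Y) (h Z) + curv (h Y) (h Z) (L X) + curv (h Z) (L X) (h Y) = Dtors (L X) Y Z"
    using bianchi1[of "L X" "h Y" "h Z"] assms by simp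
  then have "h (curv (L X) (h Y) (h Z) + curv (h Y) (h Z) (L X) + curv (h Z) (L X) (h Y)) = 0"
    using assms by simp
  \<comment> \<open>These two terms are horizontal and \<open>curv (h Y) (h Z) (L X)\<close> is
    vertical, so \<open>h\<close> separates them.\<close>
  then have "curv (L X) (h Y) (h Z) + curv (h Z) (L X) (h Y) = 0"
    using assms by (simp add: h_simps curv_h curv_L)
  then show ?thesis using b by (metis (no_types, lifting) add.assoc add.commute add.right_neutral)
qed

text \<open>By \<open>curv_eq_Dtors\<close> and parallelism of \<open>L\<close>, the sum is
  \<open>L\<close> applied to the one in \<open>cyclic_curv\<close>.\<close>

theorem cyclic_Dtors_L:
  assumes "X \<in> V" "Y \<in> V" "Z \<in> V"
  shows "Dtors (L X) Y Z + Dtors (L Y) Z X + Dtors (L Z) X Y = 0"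
proof -
  have "Dtors (L X) Y Z + Dtors (L Y) Z X + Dtors (L Z) X Y =
      L (curv (h X) (h Y) (h Z) + curv (h Y) (h Z) (h X) + curv (h Z) (h X) (h Y))"
    using assms by (simp add: L_simps curv_h curv_L algebra_simps flip: curv_eq_Dtors)
  then show ?thesis by (simp add: cyclic_curv[OF assms])
qed

text \<open>All torsion terms of \<open>bianchi1\<close> on \<open>L X\<close>, \<open>L Y\<close>,
  \<open>h Z\<close> vanish. Its horizontal part shows that \<open>h\<close> kills
  \<open>curv (L X) (L Y) Z\<close>, which settles both components of \<open>Z\<close>.\<close>

lemma curv_vertical:
  assumes "X \<in> V" "Y \<in> V" "Z \<in> V"
  shows "curv (L X) (L Y) Z = 0"
proof -
  have h0: "h (curv (L X) (L Y) Z) = 0" if Z: "Z \<in> V" for Z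
  proof -
    have "h (curv (L X) (L Y) (h Z) + curv (L Y) (h Z) (L X) + curv (h Z) (L X) (L Y)) = 0"
      using assms Z by (subst bianchi1) (simp_all add: h_simps)
    then show ?thesis using assms Z by (simp add: h_simps curv_h curv_L)
  qed
  obtain Z' where Z': "Z' \<in> V" "Z = h Z + L Z'" using assms horizontal_decomp by metis
  \<comment> \<open>\<open>L\<close> factors through \<open>h\<close>, so it kills
    \<open>curv (L X) (L Y) Z'\<close> as well.\<close>
  have "curv (L X) (L Y) (L Z') = 0"
    using L_h[of "curv (L X) (L Y) Z'"] h0 Z' assms by (simp add: curv_L)
  moreover have "curv (L X) (L Y) (h Z) = 0"
    using h0 assms by (simp add: curv_h)
  moreover have "curv (L X) (L Y) (h Z + L Z') = curv (L X) (L Y) (h Z) + curv (L X) (L Y) (L Z')"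
    using Z'(1) assms by (simp add: curv_def D_simps)
  ultimately show ?thesis by (simp flip: Z'(2))
qed

text \<open>
  As \<open>curv (L X) (L Y) = 0\<close>, the second covariant derivative of the torsion along vertical fields
  is symmetric, so that the claim is a derivative of \<open>cyclic_Dtors_L\<close> along \<open>L W\<close>.
\<close>

theorem cyclic_D_curv_L:
  assumes "X \<in> V" "Y \<in> V" "Z \<in> V" "W \<in> V"
  defines "P \<equiv> \<lambda>Y Z W. curv (h Y) (h Z) (L W)"
  defines "G \<equiv> \<lambda>X Y Z W. D (L X) (P Y Z W) - P (D (L X) Y) Z W - P Y (D (L X) Z) W - P Y Z (D (L X) W)"
  shows "G X Y Z W + G Y Z X W + G Z X Y W = 0"
proof -
  \<comment> \<open>This turns \<open>G\<close> into a second covariant derivative of the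
    torsion.\<close>
  have P: "P Y Z W = Dtors (L W) Y Z" if "Y \<in> V" "Z \<in> V" "W \<in> V" for Y Z W
    using that by (simp add: P_def curv_eq_Dtors)
  \<comment> \<open>The direction of differentiation is exchanged with the vertical argument of the
    curvature.\<close>
  have sym: "G X Y Z W = G W Y Z X" if "X \<in> V" "Y \<in> V" "Z \<in> V" "W \<in> V" for X Y Z W
  proof -
    have c: "D (L X) (D (L W) U) = D (L W) (D (L X) U) + D (br (L X) (L W)) U" if "U \<in> V" for U
      using curv_vertical[of X W U] that \<open>X \<in> V\<close> \<open>W \<in> V\<close> by (simp add: curv_def algebra_simps)
    \<comment> \<open>Vanishing torsion matches the bracket term of \<open>c\<close> with the
      correction terms in \<open>D (L X) W\<close> and \<open>D (L W) X\<close>.\<close>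
    have "br (L X) (L W) = D (L X) (L W) - D (L W) (L X)"
      using torsion_L[of X "L W"] that by (simp add: algebra_simps)
    then have t: "D (br (L X) (L W)) U = D (D (L X) (L W)) U - D (D (L W) (L X)) U" if "U \<in> V" for U
      using that \<open>X \<in> V\<close> \<open>W \<in> V\<close> by (simp add: D_simps)
    show ?thesis
      using that c[of "tors Y Z"] c[of Y] c[of Z]
      by (simp add: G_def P Dtors_def D_simps tors_simps c t flip: D_L)
  qed
  \<comment> \<open>Now all derivatives are along \<open>L W\<close>: each of the four groups is an
    instance of \<open>cyclic_Dtors_L\<close>, the last three with one field replaced by its
    derivative.\<close>
  have "G W Y Z X + G W Z X Y + G W X Y Z =
      D (L W) (Dtors (L X) Y Z + Dtors (L Y) Z X + Dtors (L Z) X Y)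
      - (Dtors (L (D (L W) X)) Y Z + Dtors (L Y) Z (D (L W) X) + Dtors (L Z) (D (L W) X) Y)
      - (Dtors (L X) (D (L W) Y) Z + Dtors (L (D (L W) Y)) Z X + Dtors (L Z) X (D (L W) Y))
      - (Dtors (L X) Y (D (L W) Z) + Dtors (L Y) (D (L W) Z) X + Dtors (L (D (L W) Z)) X Y)"
    using assms(1-4) by (simp add: G_def P D_simps)
  also have "\<dots> = 0" using assms(1-4) by (simp add: cyclic_Dtors_L)
  finally show ?thesis
    using sym[of X Y Z W] sym[of Y Z X W] sym[of Z X Y W] assms(1-4) by simp
qed

end

section \<open>The Lie ring of vector fields\<close>

lemma Ck_on_cong:
  assumes "open S" "\<And>x. x \<in> S \<Longrightarrow> f x = g x" "Ck_on k S f"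
  shows "Ck_on k S g"
  using assms(2,3)
proof (induction k arbitrary: f g)
  case 0
  then show ?case by (simp cong: continuous_on_cong)
next
  case (Suc k)
  have d: "(g has_derivative frechet_derivative f (at x)) (at x)" if "x \<in> S" for x
  proof (rule has_derivative_transform_within_open[OF _ \<open>open S\<close> that])
    show "(f has_derivative frechet_derivative f (at x)) (at x)"
      using Suc.prems(2) that by (simp flip: frechet_derivative_works)
  qed (fact Suc.prems(1))
  have "Ck_on k S (\<lambda>x. frechet_derivative g (at x) v)" for v
  proof (rule Suc.IH)
    show "frechet_derivative f (at x) v = frechet_derivative g (at x) v" if "x \<in> S" for x
      using frechet_derivative_at[OF d[OF that]] by simp
    show "Ck_on k S (\<lambda>x. frechet_derivative f (at x) v)"
      using Suc.prems(2) by simp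
  qed
  then show ?case using d by (auto simp: differentiable_def)
qed

text \<open>Needed for the product rule, where one factor remains undifferentiated.\<close>

lemma Ck_on_Suc_imp: "Ck_on (Suc k) S f \<Longrightarrow> Ck_on k S f"
proof (induction k arbitrary: f)
  case 0
  then show ?case
    by (simp add: differentiable_imp_continuous_within continuous_at_imp_continuous_on)
next
  case (Suc k)
  then show ?case by (metis Ck_on.simps(2))
qed

lemma Ck_on_const: "Ck_on k S (\<lambda>x. c)"
  by (induction k arbitrary: c) auto

lemma Ck_on_add:
  assumes "open S" "Ck_on k S f" "Ck_on k S g"
  shows "Ck_on k S (\<lambda>x. f x + g x)"
  using assms(2,3)
proof (induction k arbitrary: f g)
  case 0
  then show ?case by (simp add: continuous_on_add)
next
  case (Suc k)
  have "Ck_on k S (\<lambda>x. frechet_derivative (\<lambda>x. f x + g x) (at x) v)" for v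
  \<comment> \<open>The sum rule identifies the derivative only at points of \<open>S\<close>, hence
    the congruence.\<close>
  proof (rule Ck_on_cong[OF \<open>open S\<close>])
    show "Ck_on k S (\<lambda>x. frechet_derivative f (at x) v + frechet_derivative g (at x) v)"
      using Suc by simp
    show "frechet_derivative f (at x) v + frechet_derivative g (at x) v =
      frechet_derivative (\<lambda>x. f x + g x) (at x) v" if "x \<in> S" for x
    proof -
      have "((\<lambda>x. f x + g x) has_derivative
          (\<lambda>h. frechet_derivative f (at x) h + frechet_derivative g (at x) h)) (at x)"
        using Suc.prems that by (intro has_derivative_add) (auto simp flip: frechet_derivative_works)
      from fun_cong[OF frechet_derivative_at[OF this], of v] show ?thesis .
    qed
  qed
  then show ?case using Suc.prems by simp
qed

lemma Ck_on_mult: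
  fixes f g :: "'a::real_normed_vector \<Rightarrow> 'b::real_normed_algebra"
  assumes "open S" "Ck_on k S f" "Ck_on k S g"
  shows "Ck_on k S (\<lambda>x. f x * g x)"
  using assms(2,3)
proof (induction k arbitrary: f g)
  case 0
  then show ?case by (simp add: continuous_on_mult)
next
  case (Suc k)
  have "Ck_on k S (\<lambda>x. frechet_derivative (\<lambda>x. f x * g x) (at x) v)" for v
  proof (rule Ck_on_cong[OF \<open>open S\<close>])
    show "Ck_on k S (\<lambda>x. f x * frechet_derivative g (at x) v + frechet_derivative f (at x) v * g x)"
      using Suc Ck_on_Suc_imp[of k S] by (intro Ck_on_add \<open>open S\<close> Suc.IH) auto
    show "f x * frechet_derivative g (at x) v + frechet_derivative f (at x) v * g x =
      frechet_derivative (\<lambda>x. f x * g x) (at x) v" if "x \<in> S" for x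
    proof -
      have "((\<lambda>x. f x * g x) has_derivative
          (\<lambda>h. f x * frechet_derivative g (at x) h + frechet_derivative f (at x) h * g x)) (at x)"
        using Suc.prems that by (intro has_derivative_mult) (auto simp flip: frechet_derivative_works)
      from fun_cong[OF frechet_derivative_at[OF this], of v] show ?thesis .
    qed
  qed
  then show ?case using Suc.prems by simp
qed

section \<open>Tangent vectors, vector fields and their bracket\<close>

locale smooth_atlas =
  fixes A :: "('m::{t2_space,second_countable_topology}, 'e::real_normed_vector) atlas"
    and d :: nat
  assumes manifold: "smooth_manifold A d"
begin

lemma open_chart_image: "(U, \<phi>) \<in> A \<Longrightarrow> open (\<phi> ` U)"
  using manifold by (auto simp: smooth_manifold_def)

lemma smooth_fun_const [simp]: "smooth_fun A (\<lambda>x. c)"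
  by (auto simp: smooth_fun_def smooth_on_def comp_def Ck_on_const)

lemma smooth_fun_add [simp]: "smooth_fun A f \<Longrightarrow> smooth_fun A g \<Longrightarrow> smooth_fun A (\<lambda>x. f x + g x)"
  by (fastforce simp: smooth_fun_def smooth_on_def comp_def dest: open_chart_image intro: Ck_on_add)

lemma smooth_fun_mult [simp]: "smooth_fun A f \<Longrightarrow> smooth_fun A g \<Longrightarrow> smooth_fun A (\<lambda>x. f x * g x)"
  by (fastforce simp: smooth_fun_def smooth_on_def comp_def dest: open_chart_image intro: Ck_on_mult)

lemma smooth_fun_uminus [simp]: "smooth_fun A f \<Longrightarrow> smooth_fun A (\<lambda>x. - f x)"
  using smooth_fun_mult[of "\<lambda>x. - 1" f] by simp

lemma smooth_fun_diff [simp]: "smooth_fun A f \<Longrightarrow> smooth_fun A g \<Longrightarrow> smooth_fun A (\<lambda>x. f x - g x)"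
  using smooth_fun_add[of f "\<lambda>x. - g x"] by simp

lemma
  assumes "v \<in> tangent_space A p"
  shows tangent_add: "smooth_fun A f \<Longrightarrow> smooth_fun A g \<Longrightarrow> v (\<lambda>x. f x + g x) = v f + v g"
    and tangent_scale: "smooth_fun A f \<Longrightarrow> v (\<lambda>x. c * f x) = c * v f"
    and tangent_mult: "smooth_fun A f \<Longrightarrow> smooth_fun A g \<Longrightarrow> v (\<lambda>x. f x * g x) = f p * v g + g p * v f"
    and tangent_not_smooth: "\<not> smooth_fun A f \<Longrightarrow> v f = 0"
  using assms by (simp_all add: tangent_space_def plus_fun_def times_fun_def)

lemma tangent_zero: "v \<in> tangent_space A p \<Longrightarrow> v (\<lambda>x. 0) = 0"
  using tangent_scale[of v p "\<lambda>x. 0" 0] by simp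

lemma tangent_uminus: "v \<in> tangent_space A p \<Longrightarrow> smooth_fun A f \<Longrightarrow> v (\<lambda>x. - f x) = - v f"
  using tangent_scale[of v p f "- 1"] by simp

lemma tangent_diff:
  "v \<in> tangent_space A p \<Longrightarrow> smooth_fun A f \<Longrightarrow> smooth_fun A g \<Longrightarrow> v (\<lambda>x. f x - g x) = v f - v g"
  using tangent_add[of v p f "\<lambda>x. - g x"] tangent_uminus[of v p g] by simp

lemma tangent_spaceI:
  assumes "\<And>f g. smooth_fun A f \<Longrightarrow> smooth_fun A g \<Longrightarrow> v (\<lambda>x. f x + g x) = v f + v g"
    and "\<And>c f. smooth_fun A f \<Longrightarrow> v (\<lambda>x. c * f x) = c * v f"
    and "\<And>f g. smooth_fun A f \<Longrightarrow> smooth_fun A g \<Longrightarrow> v (\<lambda>x. f x * g x) = f p * v g + g p * v f"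
    and "\<And>f. \<not> smooth_fun A f \<Longrightarrow> v f = 0"
  shows "v \<in> tangent_space A p"
  using assms by (simp add: tangent_space_def plus_fun_def times_fun_def)

lemmas tangent_simps = tangent_add tangent_scale tangent_mult tangent_not_smooth
  tangent_zero tangent_uminus tangent_diff

lemma tangent_space_add:
  assumes v: "v \<in> tangent_space A p" and w: "w \<in> tangent_space A p"
  shows "v + w \<in> tangent_space A p"
  by (rule tangent_spaceI) (simp_all add: tangent_simps[OF v] tangent_simps[OF w] algebra_simps)

lemma tangent_space_tscale:
  assumes v: "v \<in> tangent_space A p"
  shows "tscale c v \<in> tangent_space A p"
  by (rule tangent_spaceI) (simp_all add: tscale_def tangent_simps[OF v] algebra_simps)

lemma tangent_space_zero: "0 \<in> tangent_space A p"
  by (rule tangent_spaceI) simp_all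

lemma vector_field_tangent: "X \<in> vector_fields A \<Longrightarrow> X p \<in> tangent_space A p"
  and vector_field_smooth: "X \<in> vector_fields A \<Longrightarrow> smooth_fun A f \<Longrightarrow> smooth_fun A (\<lambda>p. X p f)"
  by (auto simp: vector_fields_def)

lemma vector_fieldI:
  assumes "\<And>p. X p \<in> tangent_space A p"
    and "\<And>f. smooth_fun A f \<Longrightarrow> smooth_fun A (\<lambda>p. X p f)"
  shows "X \<in> vector_fields A"
  using assms by (simp add: vector_fields_def)

lemmas vector_field_simps = vector_field_smooth tangent_simps[OF vector_field_tangent]

lemma vector_fields_tscale:
  assumes X: "X \<in> vector_fields A"
  shows "(\<lambda>p. tscale c (X p)) \<in> vector_fields A"
proof (rule vector_fieldI)
  show "tscale c (X p) \<in> tangent_space A p" for p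
    by (rule tangent_space_tscale[OF vector_field_tangent[OF X]])
qed (simp add: tscale_def vector_field_smooth[OF X])

text \<open>In the product rule, the mixed products of first derivatives cancel between the two
  orders.\<close>

lemma lie_bracket_in:
  assumes X: "X \<in> vector_fields A" and Y: "Y \<in> vector_fields A"
  shows "lie_bracket X Y \<in> vector_fields A"
proof (rule vector_fieldI)
  show "lie_bracket X Y p \<in> tangent_space A p" for p
    by (rule tangent_spaceI)
      (simp_all add: lie_bracket_def vector_field_simps[OF X] vector_field_simps[OF Y] algebra_simps)
qed (simp add: lie_bracket_def vector_field_smooth[OF X] vector_field_smooth[OF Y])

sublocale lie_ring_on "vector_fields A" lie_bracket
proof
  show "0 \<in> vector_fields A"
    by (simp add: vector_fields_def tangent_space_zero)
  show "X + Y \<in> vector_fields A" if X: "X \<in> vector_fields A" and Y: "Y \<in> vector_fields A" for X Y :: "'m vfield"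
  proof (rule vector_fieldI)
    show "(X + Y) p \<in> tangent_space A p" for p
      using tangent_space_add[OF vector_field_tangent[OF X] vector_field_tangent[OF Y]] by simp
  qed (simp add: vector_field_smooth[OF X] vector_field_smooth[OF Y])
  show "- X \<in> vector_fields A" if "X \<in> vector_fields A" for X :: "'m vfield"
    using vector_fields_tscale[OF that, of "- 1"] by (simp add: tscale_def fun_Compl_def)
  fix X Y Z :: "'m vfield"
  show "lie_bracket X Y = - lie_bracket Y X"
    by (simp add: lie_bracket_def fun_eq_iff)
  assume X: "X \<in> vector_fields A" and Y: "Y \<in> vector_fields A"
  then show "lie_bracket X Y \<in> vector_fields A" by (rule lie_bracket_in)
  assume Z: "Z \<in> vector_fields A"
  note s = lie_bracket_def vector_field_simps[OF X] vector_field_simps[OF Y] vector_field_simps[OF Z]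
  show "lie_bracket (X + Y) Z = lie_bracket X Z + lie_bracket Y Z"
  proof (intro ext)
    fix p f
    show "lie_bracket (X + Y) Z p f = (lie_bracket X Z + lie_bracket Y Z) p f"
      \<comment> \<open>On a non-smooth \<open>f\<close> the fields give 0, so all inner functions
        are zero; on a smooth one the derivations split over sums.\<close>
      by (cases "smooth_fun A f") (simp_all add: s)
  qed
  show "lie_bracket X (lie_bracket Y Z) + lie_bracket Y (lie_bracket Z X) + lie_bracket Z (lie_bracket X Y) = 0"
  proof (intro ext)
    fix p f
    show "(lie_bracket X (lie_bracket Y Z) + lie_bracket Y (lie_bracket Z X) + lie_bracket Z (lie_bracket X Y)) p f = 0 p f"
      by (cases "smooth_fun A f") (simp_all add: s)
  qed
qed

end

section \<open>The Berwald lift of a conservative connection\<close>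

text \<open>Stands in for division by 2: facts about the projector are proved in doubled form
  through \<open>h_add_h\<close>.\<close>

lemma vfield_double_cancel:
  fixes X Y :: "'m vfield"
  assumes "X + X = Y + Y"
  shows "X = Y"
proof (intro ext)
  fix p f
  have "(X + X) p f = (Y + Y) p f" using assms by simp
  then show "X p f = Y p f" by simp
qed

lemma (in smooth_atlas) additive_on_act:
  assumes "K \<in> vector_1_forms A"
  shows "additive_on (act K)"
  unfolding additive_on_def
proof (intro ballI ext)
  fix X Y :: "'m vfield" and p f
  assume "X \<in> vector_fields A" "Y \<in> vector_fields A"
  then have "K p (X p + Y p) = K p (X p) + K p (Y p)"
    using assms vector_field_tangent by (auto simp: vector_1_forms_def tlinear_on_def)
  then show "(K \<odot> (X + Y)) p f = (K \<odot> X + K \<odot> Y) p f"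
    by (simp add: act_def)
qed

locale conservative_berwald_lift = smooth_atlas A "2 * n"
  for A :: "('m::{t2_space,second_countable_topology}, 'e::real_normed_vector) atlas" and n :: nat +
  fixes L \<Gamma> :: "'m endo_field" and C :: "'m vfield" and D :: "'m connection"
  assumes L_structure: "L_structure A n L C"
    and conservative: "conservative A L C \<Gamma>"
    and Berwald: "Berwald_L_lift A L C \<Gamma> D"
begin

lemma L_form: "L \<in> vector_1_forms A"
  using L_structure by (simp add: L_structure_def)

lemma \<Gamma>_form: "\<Gamma> \<in> vector_1_forms A"
  using conservative by (simp add: conservative_def L_connection_def)

lemma act_in [simp]:
  assumes "X \<in> vector_fields A"
  shows "L \<odot> X \<in> vector_fields A" "\<Gamma> \<odot> X \<in> vector_fields A"
  using assms L_form \<Gamma>_form by (auto simp: vector_1_forms_def)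

lemmas act_simps =
  additive_on_add[OF additive_on_act[OF L_form]] additive_on_diff[OF additive_on_act[OF L_form]]
  additive_on_uminus[OF additive_on_act[OF L_form]] additive_on_zero[OF additive_on_act[OF L_form]]
  additive_on_add[OF additive_on_act[OF \<Gamma>_form]] additive_on_diff[OF additive_on_act[OF \<Gamma>_form]]
  additive_on_uminus[OF additive_on_act[OF \<Gamma>_form]]

lemma L_act:
  assumes "X \<in> vector_fields A"
  shows L_L_act: "L \<odot> L \<odot> X = 0" and L_\<Gamma>_act: "L \<odot> \<Gamma> \<odot> X = L \<odot> X"
    and \<Gamma>_L_act: "\<Gamma> \<odot> L \<odot> X = - (L \<odot> X)"
proof -
  have T: "X p \<in> tangent_space A p" for p using assms by (rule vector_field_tangent)
  have "L p (L p (X p)) = 0" for p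
    using L_structure T[of p] unfolding L_structure_def by blast
  then show "L \<odot> L \<odot> X = 0" by (simp add: act_def fun_eq_iff)
  show "L \<odot> \<Gamma> \<odot> X = L \<odot> X" "\<Gamma> \<odot> L \<odot> X = - (L \<odot> X)"
    using conservative T by (simp_all add: conservative_def L_connection_def act_def fun_eq_iff)
qed

text \<open>Reversing both brackets in \<open>[L,S] = - [S,L]\<close> puts \<open>S\<close> on the
  right, as \<open>fn_bracket_spray\<close> expects.\<close>

lemma spray:
  obtains S where "S \<in> vector_fields A"
    and "\<And>X. X \<in> vector_fields A \<Longrightarrow> \<Gamma> \<odot> X = lie_bracket (L \<odot> X) S - L \<odot> lie_bracket X S"
proof -
  obtain S where S: "S \<in> vector_fields A"
    and \<Gamma>: "\<And>X. X \<in> vector_fields A \<Longrightarrow> \<Gamma> \<odot> X = fn_bracket_10 L S X"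
    using conservative by (auto simp: conservative_def L_spray_def)
  have "\<Gamma> \<odot> X = lie_bracket (L \<odot> X) S - L \<odot> lie_bracket X S" if X: "X \<in> vector_fields A" for X
    unfolding \<Gamma>[OF X] fn_bracket_10_def fn_bracket_01_def br_anti[of "L \<odot> X" S] br_anti[of X S]
    using S X by (simp add: act_simps)
  with S that show thesis by blast
qed

text \<open>If \<open>L V = 0\<close>, then \<open>- V = \<Gamma> V = - L [V,S]\<close>: vertical fields have global \<open>L\<close>-preimages.\<close>

lemma vertical_field:
  assumes V: "V \<in> vector_fields A" "L \<odot> V = 0"
  shows "\<exists>Y\<in>vector_fields A. V = L \<odot> Y"
proof -
  obtain S where S: "S \<in> vector_fields A"
    "\<And>X. X \<in> vector_fields A \<Longrightarrow> \<Gamma> \<odot> X = lie_bracket (L \<odot> X) S - L \<odot> lie_bracket X S"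
    using spray by blast
  have "\<Gamma> p (V p) = - V p" for p
  proof -
    have "L p (V p) = 0" using fun_cong[OF V(2), of p] by (simp add: act_def)
    then have "V p \<in> L p ` tangent_space A p"
      using L_structure V(1) by (simp add: L_structure_def vector_field_tangent)
    then show ?thesis
      using conservative by (auto simp: conservative_def L_connection_def)
  qed
  then have "\<Gamma> \<odot> V = - V" by (simp add: act_def fun_eq_iff)
  moreover have "\<Gamma> \<odot> V = - (L \<odot> lie_bracket V S)" using S V by simp
  ultimately have "V = L \<odot> lie_bracket V S" by simp
  then show ?thesis using S(1) V(1) br_in by blast
qed

text \<open>\<open>\<Gamma> \<odot> X - X\<close> is killed by \<open>L\<close>, hence vertical, and
  \<open>\<Gamma>\<close> is minus the identity there.\<close>

lemma \<Gamma>_\<Gamma>: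
  assumes X: "X \<in> vector_fields A"
  shows "\<Gamma> \<odot> \<Gamma> \<odot> X = X"
proof -
  have "L \<odot> (\<Gamma> \<odot> X - X) = 0" using X by (simp add: act_simps L_act)
  then obtain Y where Y: "Y \<in> vector_fields A" "\<Gamma> \<odot> X - X = L \<odot> Y"
    using vertical_field X by (metis act_in(2) diff_in)
  have "\<Gamma> \<odot> \<Gamma> \<odot> X - \<Gamma> \<odot> X = \<Gamma> \<odot> (\<Gamma> \<odot> X - X)" using X by (simp add: act_simps)
  also have "\<dots> = - (\<Gamma> \<odot> X - X)" using Y by (simp add: L_act)
  finally show ?thesis by simp
qed

section \<open>The horizontal projector\<close>

abbreviation h :: "'m vfield \<Rightarrow> 'm vfield" where
  "h X \<equiv> hproj \<Gamma> \<odot> X"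

lemma h_add_h: "h X + h X = X + \<Gamma> \<odot> X"
  by (simp add: act_def hproj_def tscale_def fun_eq_iff)

lemma h_in: "X \<in> vector_fields A \<Longrightarrow> h X \<in> vector_fields A"
  using vector_fields_tscale[OF add_in[OF _ act_in(2)], of X X "1/2"] by (simp add: act_def hproj_def)

lemma additive_on_hproj: "additive_on (act (hproj \<Gamma>))"
  unfolding additive_on_def
proof (intro ballI, rule vfield_double_cancel)
  fix X Y assume X: "X \<in> vector_fields A" and Y: "Y \<in> vector_fields A"
  have "h (X + Y) + h (X + Y) = (X + \<Gamma> \<odot> X) + (Y + \<Gamma> \<odot> Y)"
    unfolding h_add_h using X Y by (simp add: act_simps add_ac)
  also have "\<dots> = (h X + h X) + (h Y + h Y)" unfolding h_add_h ..
  also have "\<dots> = (h X + h Y) + (h X + h Y)" by (simp add: add_ac)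
  finally show "h (X + Y) + h (X + Y) = (h X + h Y) + (h X + h Y)" .
qed

lemma L_hproj: "X \<in> vector_fields A \<Longrightarrow> L \<odot> h X = L \<odot> X"
  using act_simps(1)[of "h X" "h X"]
  by (rule_tac vfield_double_cancel) (simp add: h_in h_add_h act_simps L_act)

lemma \<Gamma>_hproj: "X \<in> vector_fields A \<Longrightarrow> \<Gamma> \<odot> h X = h X"
  using act_simps(5)[of "h X" "h X"]
  by (rule_tac vfield_double_cancel) (simp add: h_in h_add_h act_simps \<Gamma>_\<Gamma> add.commute)

lemma hproj_L: "X \<in> vector_fields A \<Longrightarrow> hproj \<Gamma> \<odot> L \<odot> X = 0"
  using h_add_h[of "L \<odot> X"] by (rule_tac vfield_double_cancel) (simp add: L_act)

lemma hproj_hproj: "X \<in> vector_fields A \<Longrightarrow> h (h X) = h X"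
  using h_add_h[of "h X"] by (rule_tac vfield_double_cancel) (simp add: \<Gamma>_hproj)

text \<open>\<open>fn_bracket_spray\<close> taken on \<open>h X\<close> and \<open>h Y\<close>,
  where \<open>\<Gamma>\<close> acts as the identity.\<close>

lemma L_torsion_hproj:
  assumes X: "X \<in> vector_fields A" and Y: "Y \<in> vector_fields A"
  shows "lie_bracket (L \<odot> X) (h Y) + lie_bracket (h X) (L \<odot> Y)
    = L \<odot> lie_bracket (h X) (h Y) + h (lie_bracket (L \<odot> X) (h Y)) + h (lie_bracket (h X) (L \<odot> Y))"
proof -
  obtain S where S: "S \<in> vector_fields A"
    "\<And>X. X \<in> vector_fields A \<Longrightarrow> \<Gamma> \<odot> X = lie_bracket (L \<odot> X) S - L \<odot> lie_bracket X S"
    using spray by blast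
  have N: "lie_bracket (L \<odot> X) (L \<odot> Y) = L \<odot> lie_bracket (L \<odot> X) Y + L \<odot> lie_bracket X (L \<odot> Y)"
    if "X \<in> vector_fields A" "Y \<in> vector_fields A" for X Y
  proof (rule vfield_double_cancel)
    have "fn_bracket_11 L L X Y = 0"
      using L_structure that by (simp add: L_structure_def)
    then show "lie_bracket (L \<odot> X) (L \<odot> Y) + lie_bracket (L \<odot> X) (L \<odot> Y) =
      (L \<odot> lie_bracket (L \<odot> X) Y + L \<odot> lie_bracket X (L \<odot> Y)) +
      (L \<odot> lie_bracket (L \<odot> X) Y + L \<odot> lie_bracket X (L \<odot> Y))"
      using that by (simp add: fn_bracket_11_def L_act algebra_simps)
  qed
  have G: "lie_bracket (L \<odot> X) (h Y) + lie_bracket (h X) (L \<odot> Y)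
      = L \<odot> lie_bracket (h X) (h Y) + \<Gamma> \<odot> lie_bracket (L \<odot> X) (h Y)
      + (L \<odot> lie_bracket (h X) (h Y) + \<Gamma> \<odot> lie_bracket (h X) (L \<odot> Y))"
    using fn_bracket_spray[of "act L" "act \<Gamma>" S "h X" "h Y", OF additive_on_act[OF L_form] _ _ N S(2) S(1)]
      X Y by (simp add: h_in L_hproj \<Gamma>_hproj L_L_act add.assoc)
  show ?thesis
  proof (rule vfield_double_cancel)
    let ?P = "lie_bracket (L \<odot> X) (h Y)" and ?Q = "lie_bracket (h X) (L \<odot> Y)"
      and ?R = "L \<odot> lie_bracket (h X) (h Y)"
    \<comment> \<open>Only one copy of \<open>?P + ?Q\<close> is rewritten by \<open>G\<close>; the
      other supplies the summands that complete \<open>\<Gamma>\<close> to twice the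
      projector.\<close>
    have "(?P + ?Q) + (?P + ?Q) = (?R + ?R) + (?P + \<Gamma> \<odot> ?P) + (?Q + \<Gamma> \<odot> ?Q)"
      by (subst G) (simp add: algebra_simps)
    then show "(?P + ?Q) + (?P + ?Q) = (?R + h ?P + h ?Q) + (?R + h ?P + h ?Q)"
      unfolding h_add_h[symmetric] by (simp add: algebra_simps)
  qed
qed

section \<open>The Berwald lift as a model of the abstract setting\<close>

lemma linear_connection: "linear_connection A D"
  and D_act_L: "X \<in> vector_fields A \<Longrightarrow> Y \<in> vector_fields A \<Longrightarrow> cov D X (L \<odot> Y) = L \<odot> cov D X Y"
  and D_act_\<Gamma>: "X \<in> vector_fields A \<Longrightarrow> Y \<in> vector_fields A \<Longrightarrow> cov D X (\<Gamma> \<odot> Y) = \<Gamma> \<odot> cov D X Y"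
  and torsion_act_L: "X \<in> vector_fields A \<Longrightarrow> Y \<in> vector_fields A \<Longrightarrow> torsion D (L \<odot> X) Y = 0"
  using Berwald by (simp_all add: Berwald_L_lift_def reducible_L_lift_def L_lift_def L_normal_def
    L_almost_tangent_def)

lemma cov_in: "X \<in> vector_fields A \<Longrightarrow> Y \<in> vector_fields A \<Longrightarrow> cov D X Y \<in> vector_fields A"
  using linear_connection by (simp add: linear_connection_def)

lemma additive_on_cov_left:
  assumes Y: "Y \<in> vector_fields A"
  shows "additive_on (\<lambda>X. cov D X Y)"
  unfolding additive_on_def
proof (intro ballI ext)
  fix X X' p f
  assume "X \<in> vector_fields A" "X' \<in> vector_fields A"
  then have "D p (X p + X' p) Y = D p (X p) Y + D p (X' p) Y"
    using linear_connection Y vector_field_tangent by (simp add: linear_connection_def tlinear_on_def)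
  then show "cov D (X + X') Y p f = (cov D X Y + cov D X' Y) p f"
    by (simp add: cov_def)
qed

lemma additive_on_cov_right:
  assumes X: "X \<in> vector_fields A"
  shows "additive_on (cov D X)"
  using linear_connection vector_field_tangent[OF X]
  by (simp add: additive_on_def linear_connection_def cov_def fun_eq_iff)

lemma D_act_hproj:
  assumes X: "X \<in> vector_fields A" and Y: "Y \<in> vector_fields A"
  shows "cov D X (h Y) = h (cov D X Y)"
proof (rule vfield_double_cancel)
  note add = additive_on_add[OF additive_on_cov_right[OF X]]
  have "cov D X (h Y) + cov D X (h Y) = cov D X (h Y + h Y)"
    by (rule add[symmetric]) (rule h_in[OF Y])+
  also have "\<dots> = cov D X Y + \<Gamma> \<odot> cov D X Y" unfolding h_add_h using X Y by (simp add: add D_act_\<Gamma>)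
  finally show "cov D X (h Y) + cov D X (h Y) = h (cov D X Y) + h (cov D X Y)"
    unfolding h_add_h .
qed

sublocale berwald "vector_fields A" lie_bracket "act L" "act (hproj \<Gamma>)" "cov D"
proof
  fix X Y assume X: "X \<in> vector_fields A" and Y: "Y \<in> vector_fields A"
  show "cov D (L \<odot> X) Y - cov D Y (L \<odot> X) - lie_bracket (L \<odot> X) Y = 0"
    using torsion_act_L[OF X Y] by (simp add: torsion_def)
qed (fact additive_on_act[OF L_form] act_in(1) additive_on_hproj h_in L_hproj hproj_L hproj_hproj
  vertical_field L_torsion_hproj additive_on_cov_left additive_on_cov_right cov_in D_act_L
  D_act_hproj)+

lemma conn_curvature_eq_tors:
  assumes X: "X \<in> vector_fields A" and Y: "Y \<in> vector_fields A"
  shows "conn_curvature \<Gamma> X Y = tors X Y"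
proof (rule vfield_double_cancel)
  have "conn_curvature \<Gamma> X Y + conn_curvature \<Gamma> X Y = - fn_bracket_11 (hproj \<Gamma>) (hproj \<Gamma>) X Y"
    by (simp add: conn_curvature_def tscale_def fun_eq_iff)
  also have "\<dots> = tors X Y + tors X Y"
    unfolding tors_add_tors[OF X Y] fn_bracket_11_def ..
  finally show "conn_curvature \<Gamma> X Y + conn_curvature \<Gamma> X Y = tors X Y + tors X Y" .
qed

lemma cov_2form_conn_curvature:
  "X \<in> vector_fields A \<Longrightarrow> Y \<in> vector_fields A \<Longrightarrow> W \<in> vector_fields A \<Longrightarrow>
    cov_2form D W (conn_curvature \<Gamma>) X Y = Dtors W X Y"
  by (simp add: cov_2form_def conn_curvature_eq_tors Dtors_def)

lemma hh_curvature_eq_curv: "hh_curvature L \<Gamma> D X Y Z = curv (h X) (h Y) (L \<odot> Z)"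
  by (simp add: hh_curvature_def curvature_def curv_def)

end

theorem corollary4p9:
  fixes A :: "('m::{t2_space,second_countable_topology}, 'e::real_normed_vector) atlas"
    and n :: nat
    and L \<Gamma> :: "'m endo_field"
    and C X Y Z :: "'m vfield"
    and D :: "'m connection"
  assumes "smooth_manifold A (2 * n)"
    and "L_structure A n L C"
    and "conservative A L C \<Gamma>"
    and "Berwald_L_lift A L C \<Gamma> D"
    and "X \<in> vector_fields A" and "Y \<in> vector_fields A" and "Z \<in> vector_fields A"
  shows "cyclic_sum (\<lambda>X Y Z. cov_2form D (hproj \<Gamma> \<odot> X) (conn_curvature \<Gamma>) Y Z) X Y Z = 0 \<and>
         cyclic_sum (\<lambda>X Y Z. cov_2form D (L \<odot> X) (conn_curvature \<Gamma>) Y Z) X Y Z = 0 \<and>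
         (\<forall>W\<in>vector_fields A.
            cyclic_sum (\<lambda>X Y Z. cov_End_2form D (L \<odot> X) (hh_curvature L \<Gamma> D) Y Z W) X Y Z = 0)"
proof (intro conjI ballI)
  interpret conservative_berwald_lift A n L \<Gamma> C D
    using assms by unfold_locales
  show "cyclic_sum (\<lambda>X Y Z. cov_2form D (hproj \<Gamma> \<odot> X) (conn_curvature \<Gamma>) Y Z) X Y Z = 0"
    using assms(5-7) cyclic_Dtors_h by (simp add: cyclic_sum_def cov_2form_conn_curvature)
  show "cyclic_sum (\<lambda>X Y Z. cov_2form D (L \<odot> X) (conn_curvature \<Gamma>) Y Z) X Y Z = 0"
    using assms(5-7) cyclic_Dtors_L by (simp add: cyclic_sum_def cov_2form_conn_curvature)
  fix W assume "W \<in> vector_fields A"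
  then show "cyclic_sum (\<lambda>X Y Z. cov_End_2form D (L \<odot> X) (hh_curvature L \<Gamma> D) Y Z W) X Y Z = 0"
    \<comment> \<open>Unfolded, \<open>hh_curvature\<close> is the map \<open>P\<close> of
      \<open>cyclic_D_curv_L\<close> and its covariant derivative the map \<open>G\<close>.\<close>
    unfolding cyclic_sum_def cov_End_2form_def hh_curvature_eq_curv
    using assms(5-7) by (rule_tac cyclic_D_curv_L)
qed

end
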